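(* Let $Q$ be the set of prime powers, and let $N\ge 2$, $k$, $m$, $h$ be fixed integers with $1\le k\le N$, $1\le m\le N-k$ and $1\leq h\leq m-1$. Let $(X_q)_{q\in Q}$ be a sequence where $X_q$ is an $N$-dimensional vector space over $\mathbb{F}_q$, and let $(\mathcal{A}_q)_{q\in Q}$ be a sequence where $\mathcal{A}_q$ is a partial $m$-spread of $X_q$ with $|\mathcal{A}_q|\ge 2$ for all $q\in Q$. Let $\gamma=(h+1)(N+h+1-k-m)$ and let $\binom{N}{k}_q$ denote the number of $k$-dimensional subspaces of $\mathbb{F}_q^N$. Then $$\lim_{q\to+\infty}\frac{|\{U_q\leq X_q : \dim(U_q)=k,\ U_q \text{ is } (\mathcal{A}_q,h)\text{-evasive}\}|}{\binom{N}{k}_q}=\begin{cases}1 & \text{if } |\mathcal{A}_q|\in o(q^{\gamma}) \text{ as } q\to+\infty,\\ 0 & \text{if } q^{\gamma}\in o(|\mathcal{A}_q|) \text{ as } q\to+\infty.\end{cases}$$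
   Context: A partial $m$-spread of a vector space $X$ over $\mathbb{F}_q$ is a collection $\mathcal{A}$ of $m$-dimensional $\mathbb{F}_q$-subspaces of $X$ with $S\cap S'=\{0\}$ for all distinct $S,S'\in\mathcal{A}$. An $\mathbb{F}_q$-subspace $U\le X$ is $(\mathcal{A},h)$-evasive if $\dim_{\mathbb{F}_q}(U\cap S)\leq h$ for all $S\in\mathcal{A}$. Limits and little-$o$ notation are with $q$ ranging over the prime powers, $q\to+\infty$. *)

theory Defs
  imports
    "Jordan_Normal_Form.Missing_VectorSpace"
    "HOL-Number_Theory.Prime_Powers"
    "HOL-Library.Landau_Symbols"
begin

text \<open>
  Since the ground field varies with \<open>q\<close>, fields and vector spaces are the carrier-based
  structures of HOL-Algebra and of the AFP entry VectorSpace.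
  The constant \<open>vectorspace.dim\<close> (least size of a finite generating set) is unspecified for
  infinite-dimensional spaces; below it is only used for subspaces of finite-dimensional spaces.
\<close>

definition subspace_dim :: "'a ring \<Rightarrow> ('a, 'b) module \<Rightarrow> 'b set \<Rightarrow> nat" where
  "subspace_dim K V W = vectorspace.dim K (V\<lparr>carrier := W\<rparr>)"

definition subspaces_of_dim :: "'a ring \<Rightarrow> ('a, 'b) module \<Rightarrow> nat \<Rightarrow> 'b set set" where
  "subspaces_of_dim K V k = {U. VectorSpace.subspace K U V \<and> subspace_dim K V U = k}"

text \<open>The \<open>q\<close>-binomial coefficient, where \<open>K\<close> is the field with \<open>q\<close> elements and
  \<open>ring.func_space K {..<N}\<close> is the coordinate space \<open>K\<^sup>N\<close>.\<close>

definition q_binomial :: "'a ring \<Rightarrow> nat \<Rightarrow> nat \<Rightarrow> nat" where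
  "q_binomial K N k = card (subspaces_of_dim K (ring.func_space K {..<N}) k)"

definition partial_spread :: "'a ring \<Rightarrow> ('a, 'b) module \<Rightarrow> nat \<Rightarrow> 'b set set \<Rightarrow> bool" where
  "partial_spread K V m A \<longleftrightarrow>
     A \<subseteq> subspaces_of_dim K V m \<and>
     (\<forall>S\<in>A. \<forall>S'\<in>A. S \<noteq> S' \<longrightarrow> S \<inter> S' = {\<zero>\<^bsub>V\<^esub>})"

definition evasive :: "'a ring \<Rightarrow> ('a, 'b) module \<Rightarrow> 'b set set \<Rightarrow> nat \<Rightarrow> 'b set \<Rightarrow> bool" where
  "evasive K V A h U \<longleftrightarrow>
     VectorSpace.subspace K U V \<and> (\<forall>S\<in>A. subspace_dim K V (U \<inter> S) \<le> h)"

abbreviation prime_powers_at_top :: "nat filter" where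
  "prime_powers_at_top \<equiv> inf at_top (principal {q. primepow q})"

end

theory Submission
  imports Defs
begin

text \<open>
  Put \<open>r = h + 1\<close> and let \<open>f(U)\<close> be the number of linearly independent \<open>r\<close>-tuples of vectors that lie
  in \<open>U \<inter> S\<close> for some \<open>S \<in> \<A>\<close>; then \<open>U\<close> is evasive iff \<open>f(U) = 0\<close>. For a random \<open>k\<close>-dimensional \<open>U\<close>,
  the mean of \<open>f\<close> is of order \<open>q ^ (r * r) * |\<A>| / q ^ \<gamma>\<close>, and a non-evasive \<open>U\<close> has \<open>f(U)\<close> at least of
  order \<open>q ^ (r * r)\<close>, so the proportion of non-evasive subspaces is at most a constant times
  \<open>|\<A>| / q ^ \<gamma>\<close>.

  For the other regime one uses the second moment. Tuples from distinct elements of \<open>\<A>\<close> are jointly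
  independent, and the events that \<open>U\<close> contains them are non-positively correlated. Pairs of tuples
  from the same element contribute at most a constant times \<open>q ^ (r * r)\<close> times the mean, because
  \<open>m \<le> N - k\<close>. Chebyshev's inequality bounds the proportion of evasive subspaces by a constant times
  \<open>q ^ \<gamma> / |\<A>|\<close>.
\<close>

section \<open>Incidence ratios\<close>

lemma prod_lessThan_add:
  fixes g :: "nat \<Rightarrow> 'a::comm_monoid_mult"
  shows "(\<Prod>i<r + t. g i) = (\<Prod>i<r. g i) * (\<Prod>i<t. g (r + i))"
  by (induction t) (simp_all add: mult_ac)

text \<open>
  For a prime power \<open>q\<close>, this is the probability that a uniformly random \<open>k\<close>-dimensional
  subspace of an \<open>n\<close>-dimensional space contains \<open>r\<close> given linearly independent vectors. For
  \<open>r > k\<close> the factor \<open>i = k\<close> makes it zero.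
\<close>

definition incidence_ratio :: "real \<Rightarrow> nat \<Rightarrow> nat \<Rightarrow> nat \<Rightarrow> real" where
  "incidence_ratio q n k r = (\<Prod>i<r. (q ^ k - q ^ i) / (q ^ n - q ^ i))"

lemma incidence_ratio_eq_0: "k < r \<Longrightarrow> incidence_ratio q n k r = 0"
  by (auto simp: incidence_ratio_def)

context
  fixes q :: real and n k :: nat
  assumes q: "q \<ge> 2" and kn: "k < n"
begin

lemma incidence_factor_nonneg: "i \<le> k \<Longrightarrow> 0 \<le> (q ^ k - q ^ i) / (q ^ n - q ^ i)"
  using q kn by (intro divide_nonneg_pos) (auto intro: power_increasing power_strict_increasing)

text \<open>After cross-multiplication the two sides differ by exactly
  \<open>(q ^ j - q ^ i) * (q ^ n - q ^ k)\<close>, which is nonnegative.\<close>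

lemma incidence_factor_mono:
  assumes "i \<le> j" "j \<le> k"
  shows "(q ^ k - q ^ j) / (q ^ n - q ^ j) \<le> (q ^ k - q ^ i) / (q ^ n - q ^ i)"
proof -
  have "q ^ i < q ^ n" "q ^ j < q ^ n"
    using assms q kn by (auto intro: power_strict_increasing)
  moreover have "0 \<le> (q ^ j - q ^ i) * (q ^ n - q ^ k)"
    using assms q kn by (intro mult_nonneg_nonneg) (auto intro: power_increasing)
  ultimately show ?thesis by (simp add: divide_simps) (simp add: algebra_simps)
qed

lemma incidence_ratio_nonneg: "0 \<le> incidence_ratio q n k r"
proof (cases "r \<le> k")
  case True
  then show ?thesis
    unfolding incidence_ratio_def by (intro prod_nonneg incidence_factor_nonneg) auto
qed (simp add: incidence_ratio_eq_0)

lemma incidence_ratio_le: "incidence_ratio q n k r \<le> (q ^ k / q ^ n) ^ r"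
proof (cases "r \<le> k")
  case True
  have "incidence_ratio q n k r \<le> (\<Prod>i<r. q ^ k / q ^ n)"
    unfolding incidence_ratio_def
  proof (intro prod_mono conjI)
    fix i assume "i \<in> {..<r}"
    with True have i: "i < k" by simp
    then show "0 \<le> (q ^ k - q ^ i) / (q ^ n - q ^ i)"
      by (intro incidence_factor_nonneg) simp
    have "q ^ i < q ^ n" "q ^ k \<le> q ^ n" using i q kn by (auto intro: power_strict_increasing power_increasing)
    then show "(q ^ k - q ^ i) / (q ^ n - q ^ i) \<le> q ^ k / q ^ n"
      using q by (simp add: divide_simps) (simp add: algebra_simps)
  qed
  then show ?thesis by simp
next
  case False
  then show ?thesis using q by (simp add: incidence_ratio_eq_0)
qed

text \<open>The factors with index \<open>r + i\<close> are compared one by one with those of index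
  \<open>i\<close>, which are at least as large. This is the non-positive correlation of the
  containment events of two jointly independent \<open>r\<close>-tuples.\<close>

lemma incidence_ratio_double: "incidence_ratio q n k (r + r) \<le> (incidence_ratio q n k r)\<^sup>2"
proof (cases "r + r \<le> k")
  case True
  have "incidence_ratio q n k (r + r) = incidence_ratio q n k r *
      (\<Prod>i<r. (q ^ k - q ^ (r + i)) / (q ^ n - q ^ (r + i)))"
    unfolding incidence_ratio_def by (rule prod_lessThan_add)
  also have "\<dots> \<le> incidence_ratio q n k r * incidence_ratio q n k r"
    unfolding incidence_ratio_def[of q n k r] using True
    by (intro mult_left_mono prod_mono conjI incidence_factor_nonneg incidence_factor_mono prod_nonneg) auto
  finally show ?thesis by (simp add: power2_eq_square)
qed (simp add: incidence_ratio_eq_0)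

end

text \<open>Since \<open>q \<ge> 2\<close>, a smaller power of \<open>q\<close> is at most half of a
  larger one. Replacing each difference by half of its leading term is what puts powers of two into
  the later constants.\<close>

lemma half_power_le_diff:
  fixes q :: real
  assumes "q \<ge> 2" "i < n"
  shows "q ^ n / 2 \<le> q ^ n - q ^ i"
proof -
  have "2 * q ^ i \<le> q ^ Suc i" using assms by simp
  also have "\<dots> \<le> q ^ n" using assms by (intro power_increasing) auto
  finally show ?thesis by simp
qed

lemma prod_power_diff_ge:
  fixes q :: real
  assumes "q \<ge> 2" "r \<le> n"
  shows "(q ^ n / 2) ^ r \<le> (\<Prod>i<r. q ^ n - q ^ i)"
proof -
  have "(\<Prod>i<r. q ^ n / 2) \<le> (\<Prod>i<r. q ^ n - q ^ i)"
    using assms by (intro prod_mono conjI half_power_le_diff) auto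
  then show ?thesis by simp
qed

lemma prod_power_diff_le:
  fixes q :: real
  assumes "q \<ge> 2" "r \<le> n"
  shows "(\<Prod>i<r. q ^ n - q ^ i) \<le> (q ^ n) ^ r"
proof -
  have "(\<Prod>i<r. q ^ n - q ^ i) \<le> (\<Prod>i<r. q ^ n)"
    using assms by (intro prod_mono conjI) (auto intro: power_increasing)
  then show ?thesis by simp
qed

lemma incidence_ratio_ge:
  assumes "q \<ge> 2" "k < n" "r \<le> k"
  shows "(q ^ k / q ^ n / 2) ^ r \<le> incidence_ratio q n k r"
proof -
  have "(q ^ k / q ^ n / 2) ^ r = (q ^ k / 2) ^ r / (q ^ n) ^ r"
    by (simp add: power_divide)
  also have "\<dots> \<le> (\<Prod>i<r. q ^ k - q ^ i) / (\<Prod>i<r. q ^ n - q ^ i)"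
    using assms prod_power_diff_ge[of q r k] prod_power_diff_le[of q r n]
    by (intro frac_le prod_pos prod_nonneg) (auto intro: power_increasing power_strict_increasing)
  also have "\<dots> = incidence_ratio q n k r"
    by (simp add: incidence_ratio_def prod_dividef)
  finally show ?thesis .
qed

section \<open>Counting subspaces of a finite vector space\<close>

text \<open>Coordinates with respect to \<open>B\<close> are a bijection from functions
  \<open>B \<rightarrow>\<^sub>E carrier K\<close>; extensionality makes the coefficient function
  unique.\<close>

lemma (in vectorspace) card_finite_basis:
  assumes "finite B" "basis B"
  shows "card (carrier V) = card (carrier K) ^ card B"
proof -
  have B: "B \<subseteq> carrier V"
    using assms(2) by (auto simp: basis_def)
  have ex1: "\<forall>v. v \<in> carrier V \<longrightarrow> (\<exists>!a. a \<in> B \<rightarrow>\<^sub>E carrier K \<and> lincomb a B = v)"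
    using basis_criterion[OF assms(1) B] assms(2) by (rule iffD1)
  have closed: "lincomb a B \<in> carrier V" if "a \<in> B \<rightarrow>\<^sub>E carrier K" for a
    using that B by (auto simp: PiE_def)
  have "bij_betw (\<lambda>a. lincomb a B) (B \<rightarrow>\<^sub>E carrier K) (carrier V)"
  proof (rule bij_betwI')
    fix a b assume "a \<in> B \<rightarrow>\<^sub>E carrier K" "b \<in> B \<rightarrow>\<^sub>E carrier K"
    then show "lincomb a B = lincomb b B \<longleftrightarrow> a = b"
      using ex1[rule_format, OF closed, of b] by blast
  next
    fix v assume "v \<in> carrier V"
    then show "\<exists>a\<in>B \<rightarrow>\<^sub>E carrier K. v = lincomb a B"
      using ex1 by metis
  qed (rule closed)
  then show ?thesis
    using assms(1) by (simp add: bij_betw_same_card[symmetric] card_PiE)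
qed

locale finite_vectorspace = vectorspace K V
  for K :: "'a ring" and V :: "('a, 'b) module" +
  assumes finite_scalars: "finite (carrier K)"
    and finite_vectors: "finite (carrier V)"
begin

abbreviation q :: nat where "q \<equiv> card (carrier K)"

lemma q_ge_2: "q \<ge> 2"
proof -
  have "card {\<zero>\<^bsub>K\<^esub>, \<one>\<^bsub>K\<^esub>} \<le> q"
    using finite_scalars by (intro card_mono) auto
  then show ?thesis by simp
qed

section \<open>Subspaces: dimension and cardinality\<close>

lemma subspace_carrier: "VectorSpace.subspace K U V \<Longrightarrow> U \<subseteq> carrier V"
  unfolding VectorSpace.subspace_def submodule_def by blast

lemma finite_subspace: "VectorSpace.subspace K U V \<Longrightarrow> finite U"
  using subspace_carrier finite_vectors finite_subset by blast

lemma subspace_Int: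
  assumes "VectorSpace.subspace K U V" "VectorSpace.subspace K W V"
  shows "VectorSpace.subspace K (U \<inter> W) V"
  using assms unfolding VectorSpace.subspace_def submodule_def by auto

lemma span_subset_iff:
  assumes "VectorSpace.subspace K U V" "S \<subseteq> carrier V"
  shows "span S \<subseteq> U \<longleftrightarrow> S \<subseteq> U"
  using assms in_own_span span_is_subset is_module by blast

lemma subspace_zero: "VectorSpace.subspace K U V \<Longrightarrow> \<zero>\<^bsub>V\<^esub> \<in> U"
  unfolding VectorSpace.subspace_def submodule_def by simp

lemma subspace_basis:
  assumes U: "VectorSpace.subspace K U V"
  obtains B where "B \<subseteq> U" "finite B" "lin_indpt B" "span B = U" "subspace_dim K V U = card B"
    "card U = q ^ card B"
proof -
  interpret U: vectorspace K "vs U" by (rule subspace_is_vs[OF U])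
  have "U.gen_set U"
    using U.in_own_span[of U] U.span_is_subset2[of U] by simp
  then have "U.fin_dim"
    unfolding U.fin_dim_def using finite_subspace[OF U] by auto
  then obtain B where B: "finite B" "U.basis B"
    using U.finite_basis_exists by blast
  have BU: "B \<subseteq> U" using B(2) by (simp add: U.basis_def)
  have *: "submodule K U V" using U by simp
  show thesis
  proof (rule that[of B])
    show "B \<subseteq> U" "finite B" by fact+
    show "lin_indpt B" "span B = U"
      using B(2) span_li_not_depend[OF BU *] by (simp_all add: U.basis_def)
    show "subspace_dim K V U = card B"
      unfolding subspace_dim_def by (rule U.dim_basis[OF B])
    show "card U = q ^ card B"
      using U.card_finite_basis[OF B] by simp
  qed
qed

lemma card_subspace: "VectorSpace.subspace K U V \<Longrightarrow> card U = q ^ subspace_dim K V U"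
  by (rule subspace_basis[of U]) simp_all

text \<open>As \<open>q \<ge> 2\<close>, exponents of \<open>q\<close> are determined by the powers.
  From here on, dimensions are handled through cardinalities.\<close>

lemma subspace_dim_eq_iff: "VectorSpace.subspace K U V \<Longrightarrow> subspace_dim K V U = k \<longleftrightarrow> card U = q ^ k"
  using card_subspace q_ge_2 by auto

lemma subspace_dim_le_iff: "VectorSpace.subspace K U V \<Longrightarrow> subspace_dim K V U \<le> h \<longleftrightarrow> card U \<le> q ^ h"
  using card_subspace q_ge_2 by auto

lemma card_span_lin_indpt:
  assumes B: "B \<subseteq> carrier V" "lin_indpt B"
  shows "card (span B) = q ^ card B"
proof -
  have sp: "VectorSpace.subspace K (span B) V" using span_is_subspace[OF B(1)] .
  then have sm: "submodule K (span B) V" by simp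
  interpret U: vectorspace K "vs (span B)" by (rule subspace_is_vs[OF sp])
  have BU: "B \<subseteq> span B" using in_own_span[OF B(1)] .
  have "U.basis B"
    unfolding U.basis_def using BU B(2) span_li_not_depend[OF BU sm] by simp
  moreover have "finite B" using B(1) finite_vectors finite_subset by blast
  ultimately show ?thesis using U.card_finite_basis by simp
qed

text \<open>\<open>S\<close> may be dependent, so it is replaced by a basis \<open>B\<close> of its
  span; then \<open>insert v B\<close> is independent and has the same span as
  \<open>insert v S\<close>.\<close>

lemma card_span_insert:
  assumes S: "S \<subseteq> carrier V" and v: "v \<in> carrier V - span S"
  shows "card (span (insert v S)) = q * card (span S)"
proof -
  have sp: "VectorSpace.subspace K (span S) V" using span_is_subspace[OF S] .
  obtain B where B: "B \<subseteq> span S" "finite B" "lin_indpt B" "span B = span S" "card (span S) = q ^ card B"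
    by (rule subspace_basis[OF sp])
  have BV: "B \<subseteq> carrier V" using B(1) subspace_carrier[OF sp] by blast
  have vB: "v \<notin> B" using B(1) v by blast
  have "lin_indpt (B \<union> {v})"
    using lin_dep_iff_in_span[OF BV B(3) _ vB] v B(4) by auto
  then have "card (span (insert v B)) = q ^ card (insert v B)"
    using card_span_lin_indpt[of "insert v B"] BV v by simp
  moreover have "span (insert v B) = span (insert v S)"
  proof
    have 1: "VectorSpace.subspace K (span (insert v S)) V" "VectorSpace.subspace K (span (insert v B)) V"
      using S BV v by (auto intro!: span_is_subspace)
    have 2: "span S \<subseteq> span (insert v S)" "span B \<subseteq> span (insert v B)" by (auto intro!: span_is_monotone)
    have 3: "v \<in> span (insert v S)" "v \<in> span (insert v B)"
      using S BV v by (auto intro!: span_mem)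
    show "span (insert v B) \<subseteq> span (insert v S)"
      using 1 2 3 B BV v by (subst span_subset_iff) auto
    show "span (insert v S) \<subseteq> span (insert v B)"
      using 1 2 3 B BV v S in_own_span[OF S] by (subst span_subset_iff) auto
  qed
  ultimately show ?thesis using B vB by simp
qed

section \<open>Linearly independent lists of vectors\<close>

primrec indep :: "'b list \<Rightarrow> bool" where
  "indep [] \<longleftrightarrow> True"
| "indep (v # xs) \<longleftrightarrow> v \<in> carrier V - span (set xs) \<and> indep xs"

lemma indep_carrier: "indep xs \<Longrightarrow> set xs \<subseteq> carrier V"
  by (induction xs) auto

lemma card_span_indep: "indep xs \<Longrightarrow> card (span (set xs)) = q ^ length xs"
  by (induction xs) (auto simp: span_empty card_span_insert indep_carrier)

text \<open>\<open>indep\<close> tests each vector against the span of its tail, so the new vectors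
  \<open>xs\<close> stand in front of the fixed ones \<open>ws\<close>.\<close>

definition indep_exts :: "'b set \<Rightarrow> 'b list \<Rightarrow> nat \<Rightarrow> 'b list set" where
  "indep_exts U ws t = {xs. length xs = t \<and> set xs \<subseteq> U \<and> indep (xs @ ws)}"

lemma finite_indep_exts: "finite U \<Longrightarrow> finite (indep_exts U ws t)"
  by (rule finite_subset[OF _ finite_lists_length_eq[of U t]]) (auto simp: indep_exts_def)

text \<open>Greedy choice: after \<open>t\<close> new vectors the forbidden span has
  \<open>q ^ (length ws + t)\<close> elements. If the list would become longer than
  \<open>n\<close>, the factor with \<open>length ws + i = n\<close> is zero, so truncated
  subtraction does no harm.\<close>

lemma card_indep_exts:
  assumes U: "VectorSpace.subspace K U V" "card U = q ^ n"
    and ws: "set ws \<subseteq> U" "indep ws"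
  shows "card (indep_exts U ws t) = (\<Prod>i<t. q ^ n - q ^ (length ws + i))"
proof (induction t)
  case 0
  have "indep_exts U ws 0 = {[]}" using ws by (auto simp: indep_exts_def)
  then show ?case by simp
next
  case (Suc t)
  have fin: "finite U" using finite_subspace U by blast
  have "indep_exts U ws (Suc t) =
      (\<lambda>(xs, v). v # xs) ` (SIGMA xs:indep_exts U ws t. U - span (set (xs @ ws)))" (is "_ = ?f ` ?A")
    using subspace_carrier[OF U(1)]
    by (fastforce simp: indep_exts_def length_Suc_conv image_iff)
  moreover have "inj_on ?f ?A" by (auto simp: inj_on_def)
  ultimately have "card (indep_exts U ws (Suc t)) = card ?A" by (simp add: card_image)
  also have "\<dots> = (\<Sum>xs\<in>indep_exts U ws t. card (U - span (set (xs @ ws))))"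
    using fin by (simp add: finite_indep_exts)
  also have "\<dots> = (\<Sum>xs\<in>indep_exts U ws t. q ^ n - q ^ (length ws + t))"
  proof (intro sum.cong refl)
    fix xs assume xs: "xs \<in> indep_exts U ws t"
    then have ind: "indep (xs @ ws)" and "set (xs @ ws) \<subseteq> U"
      using ws by (auto simp: indep_exts_def)
    then have "span (set (xs @ ws)) \<subseteq> U"
      using span_subset_iff[OF U(1)] indep_carrier by blast
    then show "card (U - span (set (xs @ ws))) = q ^ n - q ^ (length ws + t)"
      using fin U(2) card_span_indep[OF ind] xs
      by (simp add: card_Diff_subset finite_subset indep_exts_def add.commute)
  qed
  finally show ?case using Suc by simp
qed

section \<open>Subspaces of fixed dimension containing given vectors\<close>

definition subspaces_over :: "nat \<Rightarrow> 'b set \<Rightarrow> 'b set set" where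
  "subspaces_over k S = {U \<in> subspaces_of_dim K V k. S \<subseteq> U}"

lemma subspaces_of_dim_iff: "U \<in> subspaces_of_dim K V k \<longleftrightarrow> VectorSpace.subspace K U V \<and> card U = q ^ k"
  using subspace_dim_eq_iff by (auto simp: subspaces_of_dim_def)

lemma finite_subspaces_of_dim: "finite (subspaces_of_dim K V k)"
  by (rule finite_subset[of _ "Pow (carrier V)"])
    (use finite_vectors subspace_carrier in \<open>auto simp: subspaces_of_dim_def\<close>)

lemma finite_subspaces_over: "finite (subspaces_over k S)"
  unfolding subspaces_over_def using finite_subspaces_of_dim by simp

text \<open>Double counting of the extensions of \<open>ws\<close> to an independent
  \<open>k\<close>-tuple in \<open>V\<close>: each lies in exactly one \<open>k\<close>-dimensional
  subspace, namely its span.\<close>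

lemma card_subspaces_over_mult:
  assumes N: "card (carrier V) = q ^ N" and ws: "indep ws" "length ws \<le> k"
  shows "card (subspaces_over k (set ws)) * (\<Prod>i<k - length ws. q ^ k - q ^ (length ws + i))
    = (\<Prod>i<k - length ws. q ^ N - q ^ (length ws + i))"
proof -
  let ?t = "k - length ws"
  have V: "VectorSpace.subspace K (carrier V) V"
    by (auto simp: VectorSpace.subspace_def LinearCombinations.submodule_def vectorspace_axioms module_axioms M.add.inv_closed)
  have Union: "indep_exts (carrier V) ws ?t = (\<Union>U\<in>subspaces_over k (set ws). indep_exts U ws ?t)"
  proof (intro equalityI subsetI)
    fix xs assume xs: "xs \<in> indep_exts (carrier V) ws ?t"
    then have ind: "indep (xs @ ws)" and len: "length (xs @ ws) = k"
      using ws by (auto simp: indep_exts_def)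
    have C: "set (xs @ ws) \<subseteq> carrier V" using indep_carrier[OF ind] .
    have "span (set (xs @ ws)) \<in> subspaces_over k (set ws)"
      using span_is_subspace[OF C] card_span_indep[OF ind] in_own_span[OF C] len
      by (auto simp: subspaces_over_def subspaces_of_dim_iff)
    moreover have "xs \<in> indep_exts (span (set (xs @ ws))) ws ?t"
      using xs in_own_span[OF C] by (auto simp: indep_exts_def)
    ultimately show "xs \<in> (\<Union>U\<in>subspaces_over k (set ws). indep_exts U ws ?t)" by blast
  next
    fix xs assume "xs \<in> (\<Union>U\<in>subspaces_over k (set ws). indep_exts U ws ?t)"
    then show "xs \<in> indep_exts (carrier V) ws ?t"
      using subspace_carrier by (fastforce simp: indep_exts_def subspaces_over_def subspaces_of_dim_def)
  qed
  \<comment> \<open>The span has as many elements as \<open>U\<close> and is contained in it. Hence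
    an extension determines \<open>U\<close>, which makes the union above disjoint.\<close>
  have eq: "U = span (set (xs @ ws))"
    if "U \<in> subspaces_over k (set ws)" "xs \<in> indep_exts U ws ?t" for U xs
  proof -
    have U: "VectorSpace.subspace K U V" "card U = q ^ k" "set ws \<subseteq> U"
      using that by (auto simp: subspaces_over_def subspaces_of_dim_iff)
    have ind: "indep (xs @ ws)" and len: "length (xs @ ws) = k" and "set (xs @ ws) \<subseteq> U"
      using that U ws by (auto simp: indep_exts_def)
    then have "span (set (xs @ ws)) \<subseteq> U"
      using span_subset_iff[OF U(1)] indep_carrier by blast
    moreover have "card (span (set (xs @ ws))) = card U"
      using card_span_indep[OF ind] len U(2) by simp
    ultimately show ?thesis
      using card_subset_eq[OF finite_subspace[OF U(1)]] by blast
  qed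
  have "\<forall>U\<in>subspaces_over k (set ws). finite (indep_exts U ws ?t)"
    by (auto simp: subspaces_over_def subspaces_of_dim_def finite_indep_exts finite_subspace)
  moreover have "\<forall>U\<in>subspaces_over k (set ws). \<forall>W\<in>subspaces_over k (set ws).
      U \<noteq> W \<longrightarrow> indep_exts U ws ?t \<inter> indep_exts W ws ?t = {}"
    using eq by (metis disjoint_iff)
  ultimately have "card (indep_exts (carrier V) ws ?t)
      = (\<Sum>U\<in>subspaces_over k (set ws). card (indep_exts U ws ?t))"
    by (simp only: Union card_UN_disjoint[OF finite_subspaces_over])
  also have "\<dots> = (\<Sum>U\<in>subspaces_over k (set ws). \<Prod>i<?t. q ^ k - q ^ (length ws + i))"
    using ws(1) by (intro sum.cong card_indep_exts refl) (auto simp: subspaces_over_def subspaces_of_dim_iff)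
  finally show ?thesis
    using card_indep_exts[OF V N, of ws ?t] ws indep_carrier by simp
qed

text \<open>The double count is applied to \<open>ws\<close> and to the empty list; in the quotient
  the factors from index \<open>length ws\<close> on cancel. For \<open>length ws > k\<close> no
  such subspace exists and the ratio is zero.\<close>

lemma card_subspaces_over:
  assumes N: "card (carrier V) = q ^ N" and kN: "k \<le> N" and ws: "indep ws"
  shows "real (card (subspaces_over k (set ws)))
    = incidence_ratio q N k (length ws) * real (card (subspaces_of_dim K V k))"
proof (cases "length ws \<le> k")
  case True
  let ?r = "length ws"
  let ?c = "\<lambda>n i. real q ^ n - real q ^ i"
  have real_prod: "real (\<Prod>i<k - j. q ^ n - q ^ (j + i)) = (\<Prod>i<k - j. ?c n (j + i))"
    if "k \<le> n" for n j
    unfolding of_nat_prod using that q_ge_2 by (intro prod.cong refl) (auto simp: of_nat_diff intro!: power_increasing)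
  have pos: "0 < ?c n i" if "i < n" for i n
    using that q_ge_2 by (auto intro: power_strict_increasing)
  have split: "(\<Prod>i<k. ?c n i) = (\<Prod>i<?r. ?c n i) * (\<Prod>i<k - ?r. ?c n (?r + i))" for n
    using prod_lessThan_add[of "?c n" ?r "k - ?r"] True by simp
  \<comment> \<open>Here \<open>a\<close> and \<open>c\<close> stand for the products over
    \<open>i < length ws\<close> (for \<open>k\<close> and \<open>N\<close>), \<open>b\<close> and
    \<open>d\<close> for the remaining ones, \<open>x\<close> and \<open>y\<close> for the two
    numbers of subspaces.\<close>
  have cancel: "x = a / c * y" if "x * b = d" "y * (a * b) = c * d" "b > 0" "d > 0" "a > 0" "c > 0"
    for a b c d x y :: real
  proof -
    have "(x * c) * b = (a * y) * b"
      using that(1,2) by (simp add: mult_ac)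
    then show ?thesis using that(3,6) by (simp add: field_simps)
  qed
  have "real (card (subspaces_over k (set ws))) * (\<Prod>i<k - ?r. ?c k (?r + i)) = (\<Prod>i<k - ?r. ?c N (?r + i))"
    using arg_cong[OF card_subspaces_over_mult[OF N ws True], of real]
    by (simp only: of_nat_mult real_prod[OF order_refl] real_prod[OF kN])
  moreover have "real (card (subspaces_of_dim K V k)) * (\<Prod>i<k. ?c k i) = (\<Prod>i<k. ?c N i)"
    using arg_cong[OF card_subspaces_over_mult[OF N, of "[]" k], of real] real_prod[of k 0] real_prod[of N 0] kN
    by (simp add: subspaces_over_def)
  moreover have "(\<Prod>i<k - ?r. ?c k (?r + i)) > 0" "(\<Prod>i<k - ?r. ?c N (?r + i)) > 0"
     "(\<Prod>i<?r. ?c k i) > 0" "(\<Prod>i<?r. ?c N i) > 0"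
    using True kN by (intro prod_pos; simp add: pos del: diff_gt_0_iff_gt)+
  ultimately show ?thesis
    unfolding split incidence_ratio_def prod_dividef by (intro cancel)
next
  case False
  have "subspaces_over k (set ws) = {}"
  proof (intro equals0I)
    fix U assume U: "U \<in> subspaces_over k (set ws)"
    then have "span (set ws) \<subseteq> U" and fin: "finite U"
      using span_subset_iff indep_carrier[OF ws] finite_subspace
      by (auto simp: subspaces_over_def subspaces_of_dim_def)
    then have "q ^ length ws \<le> q ^ k"
      using card_mono[OF fin] card_span_indep[OF ws] U by (metis (no_types, lifting) subspaces_over_def mem_Collect_eq subspaces_of_dim_iff)
    then show False using False q_ge_2 by simp
  qed
  then show ?thesis using False by (simp add: incidence_ratio_eq_0)
qed

lemma card_subspaces_of_dim:
  assumes N: "card (carrier V) = q ^ N"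
  shows "card (subspaces_of_dim K V k) = (\<Prod>i<k. q ^ N - q ^ i) div (\<Prod>i<k. q ^ k - q ^ i)"
proof -
  have "(\<Prod>i<k. q ^ k - q ^ i) > 0"
    using q_ge_2 by (intro prod_pos) (auto intro: power_strict_increasing)
  moreover have "card (subspaces_of_dim K V k) * (\<Prod>i<k. q ^ k - q ^ i) = (\<Prod>i<k. q ^ N - q ^ i)"
    using card_subspaces_over_mult[OF N, of "[]" k] by (simp add: subspaces_over_def)
  ultimately show ?thesis by (metis nonzero_mult_div_cancel_right less_numeral_extra(3))
qed

text \<open>The counting formula depends only on \<open>q\<close>, \<open>N\<close> and
  \<open>k\<close>, so it gives the same value for \<open>V\<close> and for the coordinate
  space.\<close>

lemma q_binomial_eq:
  assumes N: "card (carrier V) = q ^ N"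
  shows "q_binomial K N k = card (subspaces_of_dim K V k)"
proof -
  let ?F = "func_space {..<N}"
  have card_F: "card (carrier ?F) = q ^ N"
    by (simp add: func_space_def card_PiE)
  then have "finite (carrier ?F)"
    using q_ge_2 by (intro card_ge_0_finite) simp
  then interpret F: finite_vectorspace K ?F
    using func_space_is_vs finite_scalars
    by (simp add: finite_vectorspace_def finite_vectorspace_axioms_def)
  show ?thesis
    unfolding q_binomial_def F.card_subspaces_of_dim[OF card_F] card_subspaces_of_dim[OF N] ..
qed

section \<open>Independent lists from several subspaces\<close>

lemma span_UnE:
  assumes A: "A \<subseteq> carrier V" and B: "B \<subseteq> carrier V" and x: "x \<in> span (A \<union> B)"
  obtains a b where "a \<in> span A" "b \<in> span B" "x = a \<oplus>\<^bsub>V\<^esub> b"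
proof -
  have sA: "VectorSpace.subspace K (span A) V" and sB: "VectorSpace.subspace K (span B) V"
    using A B by (auto intro: span_is_subspace)
  let ?S = "submodule_sum (span A) (span B)"
  have "span A \<subseteq> ?S" using in_sum_vs[OF sA sB] .
  moreover have "span B \<subseteq> ?S" using in_sum_vs[OF sB sA] vsum_comm[OF sA sB] by simp
  ultimately have "A \<union> B \<subseteq> ?S"
    using in_own_span[OF A] in_own_span[OF B] by blast
  then have "span (A \<union> B) \<subseteq> ?S"
    using span_subset_iff[OF sum_is_subspace[OF sA sB]] A B by simp
  with x show thesis
    using that unfolding submodule_sum_def by auto
qed

text \<open>If a vector \<open>v\<close> of \<open>U\<close> equals \<open>a + b\<close> with
  \<open>a\<close> in the span of \<open>us\<close> and \<open>b\<close> in that of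
  \<open>ws\<close>, then \<open>b = v - a\<close> lies in \<open>U \<inter> W\<close>, so
  \<open>b\<close> vanishes and \<open>v = a\<close> contradicts the independence of
  \<open>v # us\<close>.\<close>

lemma indep_append_trivial_Int:
  assumes U: "VectorSpace.subspace K U V" and W: "VectorSpace.subspace K W V"
    and UW: "U \<inter> W = {\<zero>\<^bsub>V\<^esub>}"
    and us: "indep us" "set us \<subseteq> U" and ws: "indep ws" "set ws \<subseteq> W"
  shows "indep (us @ ws)"
  using us
proof (induction us)
  case Nil
  then show ?case using ws by simp
next
  case (Cons v us)
  have UC: "U \<subseteq> carrier V" and WC: "W \<subseteq> carrier V" using U W subspace_carrier by auto
  have us: "set us \<subseteq> carrier V" "set ws \<subseteq> carrier V" using Cons.prems ws UC WC by auto
  have "v \<notin> span (set us \<union> set ws)"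
  proof
    assume "v \<in> span (set us \<union> set ws)"
    then obtain a b where ab: "a \<in> span (set us)" "b \<in> span (set ws)" "v = a \<oplus>\<^bsub>V\<^esub> b"
      using span_UnE[OF us] by blast
    have aU: "a \<in> U" and bW: "b \<in> W"
      using ab span_subset_iff[OF U us(1)] span_subset_iff[OF W us(2)] Cons.prems ws by auto
    have aC: "a \<in> carrier V" and bC: "b \<in> carrier V" using aU bW UC WC by auto
    have "\<ominus>\<^bsub>V\<^esub> a = (\<ominus>\<^bsub>K\<^esub> \<one>\<^bsub>K\<^esub>) \<odot>\<^bsub>V\<^esub> a" using smult_minus_1[OF aC] by simp
    then have "\<ominus>\<^bsub>V\<^esub> a \<oplus>\<^bsub>V\<^esub> v \<in> U"
      using U aU Cons.prems unfolding VectorSpace.subspace_def LinearCombinations.submodule_def by simp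
    moreover have "\<ominus>\<^bsub>V\<^esub> a \<oplus>\<^bsub>V\<^esub> v = b"
      using aC bC ab(3) by (simp add: M.a_assoc[symmetric] M.l_neg)
    ultimately have "b = \<zero>\<^bsub>V\<^esub>" using UW bW by auto
    then have "v = a" using ab aC by simp
    then show False using Cons.prems ab by simp
  qed
  then show ?case using Cons UC by auto
qed

lemma subspaces_over_insert_span:
  assumes "v \<in> span S" "S \<subseteq> carrier V"
  shows "subspaces_over k (insert v S) = subspaces_over k S"
  using assms span_subset_iff by (auto simp: subspaces_over_def subspaces_of_dim_def)

text \<open>
  The induction prepends one vector \<open>v\<close> to the list: at most \<open>q ^ d\<close> choices of \<open>v\<close> lie in the span
  of \<open>us\<close>, the other at most \<open>q ^ m\<close> choices raise \<open>d\<close> by one. The bound \<open>t \<le> d + 1\<close> ensures that the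
  first kind dominates, up to the factor \<open>2\<close> per step.
\<close>

lemma sum_subspaces_over_lists:
  fixes k m N :: nat
  defines "Q \<equiv> real q" and "n\<^sub>0 \<equiv> real (card (subspaces_of_dim K V k))"
  assumes N: "card (carrier V) = q ^ N" and kN: "k < N" and mkN: "m + k \<le> N"
    and S: "S \<subseteq> carrier V" "card S = q ^ m"
    and us: "indep us" and t: "t \<le> Suc (length us)"
  shows "(\<Sum>ws | length ws = t \<and> set ws \<subseteq> S. real (card (subspaces_over k (set us \<union> set ws))))
    \<le> n\<^sub>0 * 2 ^ t * (Q ^ k / Q ^ N) ^ length us * Q ^ (length us * t)"
  using us t
proof (induction t arbitrary: us)
  case 0
  have "{ws::'b list. length ws = 0 \<and> set ws \<subseteq> S} = {[]}" by auto
  then show ?case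
    using card_subspaces_over[OF N _ 0(1), of k] kN incidence_ratio_le[of Q k N "length us"] q_ge_2
    by (simp add: Q_def n\<^sub>0_def mult.commute mult_left_mono)
next
  case (Suc t)
  let ?d = "length us" and ?x = "Q ^ k / Q ^ N"
  let ?F = "\<lambda>us t. \<Sum>ws | length ws = t \<and> set ws \<subseteq> S. real (card (subspaces_over k (set us \<union> set ws)))"
  let ?B = "\<lambda>d. n\<^sub>0 * 2 ^ t * ?x ^ d * Q ^ (d * t)"
  have Q: "Q \<ge> 2" using q_ge_2 by (simp add: Q_def)
  have finS: "finite S" using S finite_vectors finite_subset by blast
  have usC: "set us \<subseteq> carrier V" using indep_carrier Suc.prems by simp
  have step: "?F (v # us) t \<le> (if v \<in> span (set us) then ?B ?d else ?B (Suc ?d))" if "v \<in> S" for v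
  proof (cases "v \<in> span (set us)")
    case True
    have "subspaces_over k (set (v # us) \<union> set ws) = subspaces_over k (set us \<union> set ws)"
      if "ws \<in> {ws. length ws = t \<and> set ws \<subseteq> S}" for ws
    proof -
      have "v \<in> span (set us \<union> set ws)"
        using True span_is_monotone[of "set us" "set us \<union> set ws"] by blast
      then show ?thesis
        using subspaces_over_insert_span usC that S by (auto simp: Un_least)
    qed
    then have "?F (v # us) t = ?F us t" by (intro sum.cong) auto
    then show ?thesis using Suc.IH[of us] Suc.prems True by simp
  next
    case False
    then have "indep (v # us)" using that S Suc.prems by auto
    then show ?thesis using Suc.IH[of "v # us"] Suc.prems False by simp
  qed
  have lists: "{ws. length ws = Suc t \<and> set ws \<subseteq> S} =
      (\<lambda>(v, ws). v # ws) ` (S \<times> {ws. length ws = t \<and> set ws \<subseteq> S})"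
    by (fastforce simp: length_Suc_conv image_iff)
  have "?F us (Suc t) = (\<Sum>v\<in>S. ?F (v # us) t)"
    unfolding lists
    by (subst sum.reindex)
      (auto simp: inj_on_def sum.cartesian_product
        intro!: sum.cong arg_cong[where f = "\<lambda>T. card (subspaces_over k T)"])
  also have "\<dots> \<le> (\<Sum>v\<in>S. if v \<in> span (set us) then ?B ?d else ?B (Suc ?d))"
    by (intro sum_mono step)
  also have "\<dots> = real (card (S \<inter> span (set us))) * ?B ?d + real (card (S - span (set us))) * ?B (Suc ?d)"
    using finS by (simp add: sum.If_cases Diff_eq)
  also have "\<dots> \<le> Q ^ ?d * ?B ?d + Q ^ m * ?B (Suc ?d)"
  proof (intro add_mono mult_right_mono)
    have "finite (span (set us))"
      using finite_subspace span_is_subspace[OF usC] by blast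
    then have "card (S \<inter> span (set us)) \<le> q ^ ?d"
      using card_span_indep[of us] Suc.prems by (metis card_mono Int_lower2)
    then show "real (card (S \<inter> span (set us))) \<le> Q ^ ?d"
      unfolding Q_def by (metis of_nat_le_iff of_nat_power)
    have "card (S - span (set us)) \<le> q ^ m"
      using S finS by (metis card_mono Diff_subset)
    then show "real (card (S - span (set us))) \<le> Q ^ m"
      unfolding Q_def by (metis of_nat_le_iff of_nat_power)
  qed (use Q in \<open>auto simp: n\<^sub>0_def\<close>)
  also have "Q ^ m * ?B (Suc ?d) \<le> Q ^ ?d * ?B ?d"
  proof -
    \<comment> \<open>The codimension condition \<open>m + k \<le> N\<close> says that the
      \<open>q ^ m\<close> choices of \<open>v\<close> are outweighed by the extra factor
      \<open>Q ^ k / Q ^ N\<close> that an independent \<open>v\<close> brings.\<close>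
    have "Q ^ m * Q ^ k \<le> Q ^ N"
      using Q mkN by (simp add: power_add[symmetric] power_increasing)
    then have 1: "Q ^ m * ?x \<le> 1" using Q by simp
    \<comment> \<open>\<open>(d + 1) * t \<le> d * (t + 1)\<close> is equivalent to
      \<open>t \<le> d\<close>; this is why the induction carries
      \<open>t \<le> d + 1\<close>.\<close>
    have "t \<le> ?d" using Suc.prems by simp
    then have 2: "Q ^ (Suc ?d * t) \<le> Q ^ (?d * Suc t)"
      using Q by (intro power_increasing) auto
    have "Q ^ m * ?B (Suc ?d) = (Q ^ m * ?x) * Q ^ (Suc ?d * t) * (n\<^sub>0 * 2 ^ t * ?x ^ ?d)"
      by (simp only: power_Suc mult_ac)
    also have "\<dots> \<le> 1 * Q ^ (?d * Suc t) * (n\<^sub>0 * 2 ^ t * ?x ^ ?d)"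
      using Q 1 2 by (intro mult_right_mono mult_mono) (auto simp: n\<^sub>0_def)
    also have "\<dots> = Q ^ ?d * ?B ?d"
      by (simp add: power_add)
    finally show ?thesis .
  qed
  also have "Q ^ ?d * ?B ?d + Q ^ ?d * ?B ?d = n\<^sub>0 * 2 ^ Suc t * ?x ^ ?d * Q ^ (?d * Suc t)"
    by (simp add: power_add)
  finally show ?case by simp
qed

end

section \<open>Moments for a partial spread\<close>

text \<open>In the application \<open>r\<close> is \<open>h + 1\<close>, the least intersection
  dimension that violates evasiveness.\<close>

locale partial_spread_space = finite_vectorspace K V
  for K :: "'a ring" and V :: "('a, 'b) module" +
  fixes N k m r :: nat and A :: "'b set set"
  assumes card_vectors: "card (carrier V) = q ^ N"
    and m_pos: "1 \<le> m" and mk_le: "m + k \<le> N"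
    and r_pos: "1 \<le> r" and r_le: "r \<le> m"
    and spread: "partial_spread K V m A" and spread_nonempty: "A \<noteq> {}"
begin

abbreviation Q :: real where "Q \<equiv> real q"
text \<open>The proportion of vectors of \<open>V\<close> lying in a \<open>k\<close>-dimensional
  subspace; \<open>x ^ r\<close> is the approximate size of \<open>p r\<close> when
  \<open>r \<le> k\<close>.\<close>

abbreviation x :: real where "x \<equiv> Q ^ k / Q ^ N"
abbreviation \<U> :: "'b set set" where "\<U> \<equiv> subspaces_of_dim K V k"
abbreviation n\<^sub>0 :: real where "n\<^sub>0 \<equiv> real (card \<U>)"
abbreviation p :: "nat \<Rightarrow> real" where "p \<equiv> incidence_ratio Q N k"
abbreviation tuples :: "'b set \<Rightarrow> 'b list set" where "tuples S \<equiv> indep_exts S [] r"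
abbreviation M :: real where "M \<equiv> \<Prod>i<r. Q ^ m - Q ^ i"

text \<open>
  The random variable of the moment argument. It counts tuples rather than elements of \<open>A\<close>, since
  then its moments are sums of incidence ratios; it vanishes exactly on the evasive subspaces.
\<close>

definition hits :: "'b set \<Rightarrow> real" where
  "hits U = (\<Sum>S\<in>A. \<Sum>ws\<in>tuples S. of_bool (set ws \<subseteq> U))"

lemma Q_ge_2: "Q \<ge> 2"
  using q_ge_2 by simp

lemma k_less: "k < N"
  using m_pos mk_le by simp

lemma spread_subspace:
  assumes "S \<in> A"
  shows "VectorSpace.subspace K S V" "card S = q ^ m" "S \<subseteq> carrier V" "finite S"
proof -
  have "S \<in> subspaces_of_dim K V m" using assms spread by (auto simp: partial_spread_def)
  then show "VectorSpace.subspace K S V" "card S = q ^ m" by (simp_all add: subspaces_of_dim_iff)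
  then show "S \<subseteq> carrier V" "finite S" using subspace_carrier finite_subspace by simp_all
qed

lemma finite_spread: "finite A"
  using spread finite_subspaces_of_dim finite_subset by (auto simp: partial_spread_def)

lemma card_spread_pos: "real (card A) > 0"
  using finite_spread spread_nonempty by (simp add: card_gt_0_iff)

lemma finite_tuples: "S \<in> A \<Longrightarrow> finite (tuples S)"
  by (rule finite_indep_exts) (rule spread_subspace)

lemma tuplesD: "ws \<in> tuples S \<Longrightarrow> indep ws \<and> length ws = r \<and> set ws \<subseteq> S"
  by (simp add: indep_exts_def)

section \<open>First and second moment of \<open>hits\<close>, as sums over all
  \<open>k\<close>-dimensional subspaces\<close>

lemma real_prod_power_diff:
  assumes "j \<le> n"
  shows "real (\<Prod>i<j. q ^ n - q ^ i) = (\<Prod>i<j. Q ^ n - Q ^ i)"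
  unfolding of_nat_prod using assms q_ge_2
  by (intro prod.cong refl) (auto simp: of_nat_diff intro!: power_increasing)

lemma card_tuples: "S \<in> A \<Longrightarrow> real (card (tuples S)) = M"
  using card_indep_exts[of S m "[]" r] spread_subspace[of S] real_prod_power_diff[OF r_le] by simp

lemma card_over: "indep ws \<Longrightarrow> real (card (subspaces_over k (set ws))) = p (length ws) * n\<^sub>0"
  using card_subspaces_over[OF card_vectors] k_less by simp

lemma sum_of_bool_over: "(\<Sum>U\<in>\<U>. of_bool (S \<subseteq> U)) = real (card (subspaces_over k S))"
  using finite_subspaces_of_dim by (simp add: subspaces_over_def Int_def)

text \<open>Linearity of expectation: after exchanging the sums, each of the \<open>M\<close> tuples
  of each element lies in \<open>p r * n\<^sub>0\<close> subspaces.\<close>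

lemma sum_hits: "(\<Sum>U\<in>\<U>. hits U) = real (card A) * M * p r * n\<^sub>0"
proof -
  have "(\<Sum>U\<in>\<U>. hits U) = (\<Sum>S\<in>A. \<Sum>ws\<in>tuples S. \<Sum>U\<in>\<U>. of_bool (set ws \<subseteq> U))"
    unfolding hits_def by (subst sum.swap, intro sum.cong refl, rule sum.swap)
  also have "\<dots> = (\<Sum>S\<in>A. \<Sum>ws\<in>tuples S. p r * n\<^sub>0)"
    unfolding sum_of_bool_over using card_over tuplesD by (intro sum.cong refl) metis
  also have "\<dots> = (\<Sum>S\<in>A. M * (p r * n\<^sub>0))"
    by (intro sum.cong refl) (simp only: sum_constant card_tuples)
  finally show ?thesis by simp
qed

lemma M_nonneg: "0 \<le> M"
  using Q_ge_2 r_le by (intro prod_nonneg) (auto intro: power_increasing)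

lemma p_nonneg: "0 \<le> p j"
  using incidence_ratio_nonneg[OF Q_ge_2 k_less] .

text \<open>Tuples from one element may depend on each other. The independence of \<open>us\<close>
  is dropped, and the estimate for arbitrary lists in \<open>S\<close> applies.\<close>

lemma sum_over_same_element:
  assumes S: "S \<in> A" and ws: "ws \<in> tuples S"
  shows "(\<Sum>us\<in>tuples S. real (card (subspaces_over k (set ws \<union> set us)))) \<le> n\<^sub>0 * 2 ^ r * x ^ r * Q ^ (r * r)"
proof -
  have "(\<Sum>us\<in>tuples S. real (card (subspaces_over k (set ws \<union> set us))))
      \<le> (\<Sum>us | length us = r \<and> set us \<subseteq> S. real (card (subspaces_over k (set ws \<union> set us))))"
    using spread_subspace[OF S] finite_lists_length_eq[of S r]
    by (intro sum_mono2) (auto simp: conj_commute indep_exts_def)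
  also have "\<dots> \<le> n\<^sub>0 * 2 ^ r * x ^ r * Q ^ (r * r)"
    using sum_subspaces_over_lists[OF card_vectors k_less mk_le spread_subspace(3,2)[OF S], of ws r]
      tuplesD[OF ws] by simp
  finally show ?thesis .
qed

text \<open>Elements of the spread meet trivially, so \<open>ws @ us\<close> is independent of
  length \<open>r + r\<close>, and the incidence ratio for \<open>r + r\<close> is at most the
  square of that for \<open>r\<close>.\<close>

lemma sum_over_other_element:
  assumes S: "S \<in> A" and S': "S' \<in> A" "S' \<noteq> S" and ws: "ws \<in> tuples S"
  shows "(\<Sum>us\<in>tuples S'. real (card (subspaces_over k (set ws \<union> set us)))) \<le> M * ((p r)\<^sup>2 * n\<^sub>0)"
proof -
  have "real (card (subspaces_over k (set ws \<union> set us))) \<le> (p r)\<^sup>2 * n\<^sub>0" if us: "us \<in> tuples S'" for us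
  proof -
    have "S \<inter> S' = {\<zero>\<^bsub>V\<^esub>}" using S S' spread by (auto simp: partial_spread_def)
    then have "indep (ws @ us)"
      using tuplesD[OF us] tuplesD[OF ws] spread_subspace(1) S S'
      by (intro indep_append_trivial_Int) auto
    from card_over[OF this] have "real (card (subspaces_over k (set ws \<union> set us))) = p (r + r) * n\<^sub>0"
      using tuplesD[OF us] tuplesD[OF ws] by simp
    also have "\<dots> \<le> (p r)\<^sup>2 * n\<^sub>0"
      by (intro mult_right_mono incidence_ratio_double Q_ge_2 k_less) simp
    finally show ?thesis .
  qed
  then have "(\<Sum>us\<in>tuples S'. real (card (subspaces_over k (set ws \<union> set us)))) \<le> (\<Sum>us\<in>tuples S'. (p r)\<^sup>2 * n\<^sub>0)"
    by (rule sum_mono)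
  then show ?thesis by (simp only: sum_constant card_tuples[OF S'(1)])
qed

text \<open>The square is expanded over pairs of tuples, and for each \<open>ws\<close> in
  \<open>S\<close> the sum over \<open>S'\<close> is split into \<open>S' = S\<close> and
  \<open>S' \<noteq> S\<close>.\<close>

lemma sum_hits_squared:
  "(\<Sum>U\<in>\<U>. (hits U)\<^sup>2) \<le> real (card A) * M * n\<^sub>0 * (2 ^ r * x ^ r * Q ^ (r * r) + real (card A) * M * (p r)\<^sup>2)"
proof -
  let ?c = "\<lambda>ws us. real (card (subspaces_over k (set ws \<union> set us)))"
  let ?B = "n\<^sub>0 * 2 ^ r * x ^ r * Q ^ (r * r) + real (card A) * (M * ((p r)\<^sup>2 * n\<^sub>0))"
  have sq: "(hits U)\<^sup>2 = (\<Sum>S\<in>A. \<Sum>ws\<in>tuples S. \<Sum>S'\<in>A. \<Sum>us\<in>tuples S'. of_bool (set ws \<union> set us \<subseteq> U))" for U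
  proof -
    have "(hits U)\<^sup>2 = (\<Sum>S\<in>A. \<Sum>ws\<in>tuples S. of_bool (set ws \<subseteq> U) * hits U)"
      unfolding power2_eq_square hits_def[of U] by (simp only: sum_distrib_right)
    also have "\<dots> = (\<Sum>S\<in>A. \<Sum>ws\<in>tuples S. \<Sum>S'\<in>A. \<Sum>us\<in>tuples S'. of_bool (set ws \<subseteq> U) * of_bool (set us \<subseteq> U))"
      unfolding hits_def by (simp only: sum_distrib_left)
    also have "\<dots> = (\<Sum>S\<in>A. \<Sum>ws\<in>tuples S. \<Sum>S'\<in>A. \<Sum>us\<in>tuples S'. of_bool (set ws \<union> set us \<subseteq> U))"
      by (intro sum.cong refl) auto
    finally show ?thesis .
  qed
  have "(\<Sum>U\<in>\<U>. (hits U)\<^sup>2) = (\<Sum>S\<in>A. \<Sum>ws\<in>tuples S. \<Sum>S'\<in>A. \<Sum>us\<in>tuples S'. \<Sum>U\<in>\<U>. of_bool (set ws \<union> set us \<subseteq> U))"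
    unfolding sq
    by (simp only: sum.swap[where A = \<U>])
  also have "\<dots> = (\<Sum>S\<in>A. \<Sum>ws\<in>tuples S. \<Sum>S'\<in>A. \<Sum>us\<in>tuples S'. ?c ws us)"
    unfolding sum_of_bool_over ..
  also have "\<dots> \<le> (\<Sum>S\<in>A. \<Sum>ws\<in>tuples S. ?B)"
  proof (intro sum_mono)
    fix S ws assume S: "S \<in> A" and ws: "ws \<in> tuples S"
    have "(\<Sum>S'\<in>A. \<Sum>us\<in>tuples S'. ?c ws us)
        = (\<Sum>us\<in>tuples S. ?c ws us) + (\<Sum>S'\<in>A - {S}. \<Sum>us\<in>tuples S'. ?c ws us)"
      by (rule sum.remove[OF finite_spread S])
    also have "(\<Sum>S'\<in>A - {S}. \<Sum>us\<in>tuples S'. ?c ws us) \<le> (\<Sum>S'\<in>A - {S}. M * ((p r)\<^sup>2 * n\<^sub>0))"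
      using S ws by (intro sum_mono sum_over_other_element) auto
    \<comment> \<open>Counting \<open>card A\<close> instead of \<open>card A - 1\<close> other
      elements makes this term match the squared mean, so that it cancels in the variance.\<close>
    also have "\<dots> \<le> real (card A) * (M * ((p r)\<^sup>2 * n\<^sub>0))"
      using finite_spread M_nonneg by (simp only: sum_constant)
       (intro mult_right_mono mult_nonneg_nonneg, auto intro: card_mono)
    finally show "(\<Sum>S'\<in>A. \<Sum>us\<in>tuples S'. ?c ws us) \<le> ?B"
      using sum_over_same_element[OF S ws] by linarith
  qed
  also have "\<dots> = (\<Sum>S\<in>A. M * ?B)"
    by (intro sum.cong refl) (simp only: sum_constant card_tuples)
  also have "\<dots> = real (card A) * M * n\<^sub>0 * (2 ^ r * x ^ r * Q ^ (r * r) + real (card A) * M * (p r)\<^sup>2)"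
    by (simp add: algebra_simps)
  finally show ?thesis .
qed

section \<open>Evasiveness in terms of \<open>hits\<close>\<close>

lemma evasive_iff_card: "evasive K V A h U \<longleftrightarrow> VectorSpace.subspace K U V \<and> (\<forall>S\<in>A. card (U \<inter> S) \<le> q ^ h)"
  using subspace_dim_le_iff subspace_Int spread_subspace(1) by (auto simp: evasive_def)

lemma hits_eq: "hits U = (\<Sum>S\<in>A. real (card (indep_exts (U \<inter> S) [] r)))"
proof -
  have "(\<Sum>ws\<in>tuples S. of_bool (set ws \<subseteq> U)) = real (card (indep_exts (U \<inter> S) [] r))" if "S \<in> A" for S
  proof -
    have "{ws \<in> tuples S. set ws \<subseteq> U} = indep_exts (U \<inter> S) [] r"
      by (auto simp: indep_exts_def)
    then show ?thesis using finite_tuples[OF that] by (simp add: Int_def)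
  qed
  then show ?thesis by (simp add: hits_def)
qed

lemma hits_nonneg: "0 \<le> hits U"
  unfolding hits_eq by (intro sum_nonneg) simp

text \<open>An independent \<open>r\<close>-tuple in \<open>U \<inter> S\<close> would span
  \<open>q ^ r\<close> elements there, but evasiveness allows only
  \<open>q ^ (r - 1)\<close>.\<close>

lemma hits_evasive:
  assumes "evasive K V A (r - 1) U"
  shows "hits U = 0"
proof -
  have "indep_exts (U \<inter> S) [] r = {}" if S: "S \<in> A" for S
  proof (intro equals0I)
    fix ws assume ws: "ws \<in> indep_exts (U \<inter> S) [] r"
    have US: "VectorSpace.subspace K (U \<inter> S) V"
      using assms S spread_subspace subspace_Int by (auto simp: evasive_def)
    have ind: "indep ws" "length ws = r" "set ws \<subseteq> U \<inter> S" using tuplesD[OF ws] by auto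
    then have "span (set ws) \<subseteq> U \<inter> S"
      using span_subset_iff[OF US] indep_carrier by blast
    then have "q ^ r \<le> card (U \<inter> S)"
      using card_mono[OF finite_subspace[OF US]] card_span_indep ind by metis
    also have "\<dots> \<le> q ^ (r - 1)"
      using assms S by (simp add: evasive_iff_card)
    finally show False using q_ge_2 r_pos by simp
  qed
  then show ?thesis by (simp add: hits_eq)
qed

text \<open>One intersection of dimension at least \<open>r\<close> already contains many
  independent \<open>r\<close>-tuples. This lower bound is the threshold in Markov's
  inequality.\<close>

lemma hits_not_evasive:
  assumes U: "U \<in> \<U>" and "\<not> evasive K V A (r - 1) U"
  shows "(Q ^ r / 2) ^ r \<le> hits U"
proof -
  have sU: "VectorSpace.subspace K U V" using U by (simp add: subspaces_of_dim_def)
  then obtain S where S: "S \<in> A" "\<not> subspace_dim K V (U \<inter> S) \<le> r - 1"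
    using assms by (auto simp: evasive_def)
  let ?d = "subspace_dim K V (U \<inter> S)"
  have US: "VectorSpace.subspace K (U \<inter> S) V"
    using S sU spread_subspace subspace_Int by auto
  have d: "r \<le> ?d" using S by simp
  have "(Q ^ r / 2) ^ r \<le> (Q ^ ?d / 2) ^ r"
    using d Q_ge_2 by (intro power_mono divide_right_mono power_increasing) auto
  also have "\<dots> \<le> real (card (indep_exts (U \<inter> S) [] r))"
    using card_indep_exts[OF US card_subspace[OF US], of "[]" r] prod_power_diff_ge[OF Q_ge_2 d]
      real_prod_power_diff[OF d] by simp
  also have "\<dots> \<le> hits U"
    unfolding hits_eq using S(1) finite_spread by (intro member_le_sum) auto
  finally show ?thesis .
qed

section \<open>Bounds for the proportions of evasive and non-evasive subspaces\<close>

lemma n0_pos: "n\<^sub>0 > 0"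
proof -
  have "(\<Prod>i<k. q ^ N - q ^ i) > 0"
    using k_less q_ge_2 by (intro prod_pos) (auto intro: power_strict_increasing)
  moreover have "card \<U> * (\<Prod>i<k. q ^ k - q ^ i) = (\<Prod>i<k. q ^ N - q ^ i)"
    using card_subspaces_over_mult[OF card_vectors, of "[]" k] by (simp add: subspaces_over_def)
  ultimately have "card \<U> * (\<Prod>i<k. q ^ k - q ^ i) > 0" by (simp only:)
  then show ?thesis by (simp only: nat_0_less_mult_iff of_nat_0_less_iff)
qed

abbreviation evasives :: "'b set set" where
  "evasives \<equiv> {U \<in> \<U>. evasive K V A (r - 1) U}"

abbreviation \<gamma> :: nat where "\<gamma> \<equiv> r * (N + r - k - m)"

text \<open>\<open>(Q ^ m) ^ r * x ^ r\<close> estimates the mean number of tuples from one element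
  of \<open>A\<close>. The exponent \<open>\<gamma>\<close> is what separates it from
  \<open>Q ^ (r * r)\<close>, the order of \<open>hits\<close> forced by non-evasiveness.\<close>

lemma power_\<gamma>: "Q ^ \<gamma> * ((Q ^ m) ^ r * x ^ r) = Q ^ (r * r)"
proof -
  define g where "g = N + r - k - m"
  have g: "N + r = g + m + k" using mk_le by (simp add: g_def)
  have "r * g + (m * r + k * r) = r * (g + m + k)" by (simp add: algebra_simps)
  also have "\<dots> = r * r + N * r" unfolding g[symmetric] by (simp add: algebra_simps)
  finally have "Q ^ (r * g + (m * r + k * r)) = Q ^ (r * r + N * r)" by simp
  then have "Q ^ (r * g) * ((Q ^ m) ^ r * (Q ^ k) ^ r) = Q ^ (r * r) * (Q ^ N) ^ r"
    by (simp only: power_add power_mult)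
  then have "Q ^ \<gamma> * ((Q ^ m) ^ r * (Q ^ k) ^ r) = Q ^ (r * r) * (Q ^ N) ^ r"
    by (simp only: g_def)
  moreover have "(Q ^ N) ^ r \<noteq> 0" using Q_ge_2 by simp
  ultimately show ?thesis by (simp only: power_divide times_divide_eq_right nonzero_mult_div_cancel_right not_False_eq_True)
qed

text \<open>Markov's inequality for \<open>hits\<close>: by the identity for
  \<open>Q ^ \<gamma>\<close> the factor \<open>Q ^ (r * r)\<close> cancels, and
  \<open>2 ^ r\<close> remains from the halves in the threshold.\<close>

lemma not_evasive_bound: "real (card (\<U> - evasives)) / n\<^sub>0 \<le> 2 ^ r * (real (card A) / Q ^ \<gamma>)"
proof -
  have "real (card (\<U> - evasives)) * (Q ^ r / 2) ^ r = (\<Sum>U\<in>\<U> - evasives. (Q ^ r / 2) ^ r)"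
    by simp
  also have "\<dots> \<le> (\<Sum>U\<in>\<U> - evasives. hits U)"
    by (intro sum_mono hits_not_evasive) auto
  also have "\<dots> \<le> (\<Sum>U\<in>\<U>. hits U)"
    using finite_subspaces_of_dim hits_nonneg by (intro sum_mono2) auto
  also have "\<dots> = real (card A) * (M * p r) * n\<^sub>0"
    unfolding sum_hits by simp
  also have "\<dots> \<le> real (card A) * ((Q ^ m) ^ r * x ^ r) * n\<^sub>0"
    using prod_power_diff_le[OF Q_ge_2 r_le] incidence_ratio_le[OF Q_ge_2 k_less, of r] p_nonneg Q_ge_2
    by (intro mult_right_mono mult_left_mono mult_mono) auto
  finally have "real (card (\<U> - evasives)) * (Q ^ r / 2) ^ r \<le> real (card A) * ((Q ^ m) ^ r * x ^ r) * n\<^sub>0" .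
  then have "real (card (\<U> - evasives)) * (Q ^ r / 2) ^ r * Q ^ \<gamma>
      \<le> real (card A) * ((Q ^ m) ^ r * x ^ r) * n\<^sub>0 * Q ^ \<gamma>"
    using Q_ge_2 by (intro mult_right_mono) auto
  also have "\<dots> = real (card A) * n\<^sub>0 * Q ^ (r * r)"
    unfolding power_\<gamma>[symmetric] by (simp only: mult_ac)
  finally have "Q ^ (r * r) * (real (card (\<U> - evasives)) * Q ^ \<gamma>) \<le> Q ^ (r * r) * (2 ^ r * real (card A) * n\<^sub>0)"
    by (simp add: power_divide power_mult[symmetric] field_simps)
  then have "real (card (\<U> - evasives)) * Q ^ \<gamma> \<le> 2 ^ r * real (card A) * n\<^sub>0"
    using Q_ge_2 by simp
  then show ?thesis using n0_pos Q_ge_2 by (simp add: field_simps)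
qed

text \<open>Packing: the sets of nonzero vectors of the elements are disjoint. The factor
  \<open>2\<close> comes from \<open>q ^ m - 1 \<ge> q ^ m / 2\<close>.\<close>

lemma card_spread_le: "real (card A) \<le> 2 * Q ^ (N - m)"
proof -
  have fin: "finite (S - {\<zero>\<^bsub>V\<^esub>})" if "S \<in> A" for S using spread_subspace(4)[OF that] by simp
  have disj: "\<forall>S\<in>A. \<forall>S'\<in>A. S \<noteq> S' \<longrightarrow> (S - {\<zero>\<^bsub>V\<^esub>}) \<inter> (S' - {\<zero>\<^bsub>V\<^esub>}) = {}"
    using spread unfolding partial_spread_def by blast
  have "card A * (q ^ m - 1) = (\<Sum>S\<in>A. card (S - {\<zero>\<^bsub>V\<^esub>}))"
    using spread_subspace by (simp add: card_Diff_singleton subspace_zero)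
  also have "\<dots> = card (\<Union>S\<in>A. S - {\<zero>\<^bsub>V\<^esub>})"
    using fin disj by (intro card_UN_disjoint[symmetric] finite_spread) auto
  also have "\<dots> \<le> card (carrier V)"
    using spread_subspace(3) by (intro card_mono finite_vectors) auto
  finally have "card A * (q ^ m - 1) \<le> q ^ N" by (simp only: card_vectors)
  then have "real (card A * (q ^ m - 1)) \<le> real (q ^ N)" by (simp only: of_nat_le_iff)
  then have "real (card A) * (Q ^ m - 1) \<le> Q ^ N"
    using q_ge_2 by (simp add: of_nat_diff)
  moreover have "real (card A) * (Q ^ m / 2) \<le> real (card A) * (Q ^ m - 1)"
    using half_power_le_diff[of Q 0 m] Q_ge_2 m_pos by (intro mult_left_mono) auto
  moreover have "Q ^ N = Q ^ (N - m) * Q ^ m"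
    using mk_le by (simp add: power_add[symmetric])
  ultimately have "real (card A) * Q ^ m \<le> (2 * Q ^ (N - m)) * Q ^ m" by simp
  then show ?thesis using Q_ge_2 by simp
qed

text \<open>
  Chebyshev's inequality: an evasive subspace has distance \<open>\<mu>\<close> from the mean \<open>\<mu>\<close> of \<open>hits\<close>.
\<close>

lemma evasive_variance_bound:
  "real (card evasives) * (real (card A) * M * p r)\<^sup>2 \<le> n\<^sub>0 * (real (card A) * M * (2 ^ r * x ^ r * Q ^ (r * r)))"
proof -
  define \<mu> where "\<mu> = real (card A) * M * p r"
  have "real (card evasives) * \<mu>\<^sup>2 = (\<Sum>U\<in>evasives. (hits U - \<mu>)\<^sup>2)"
    by (simp add: hits_evasive)
  also have "\<dots> \<le> (\<Sum>U\<in>\<U>. (hits U - \<mu>)\<^sup>2)"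
    using finite_subspaces_of_dim by (intro sum_mono2) auto
  also have "\<dots> = (\<Sum>U\<in>\<U>. (hits U)\<^sup>2) - 2 * \<mu> * (\<Sum>U\<in>\<U>. hits U) + n\<^sub>0 * \<mu>\<^sup>2"
    by (simp add: power2_diff sum.distrib sum_subtractf sum_distrib_left mult_ac)
  also have "(\<Sum>U\<in>\<U>. hits U) = \<mu> * n\<^sub>0"
    unfolding sum_hits \<mu>_def ..
  \<comment> \<open>The part of the second moment coming from distinct elements is at most
    \<open>n\<^sub>0 * \<mu>\<^sup>2\<close> and cancels; only pairs from the same element
    remain.\<close>
  also have "(\<Sum>U\<in>\<U>. (hits U)\<^sup>2) - 2 * \<mu> * (\<mu> * n\<^sub>0) + n\<^sub>0 * \<mu>\<^sup>2
      \<le> n\<^sub>0 * (real (card A) * M * (2 ^ r * x ^ r * Q ^ (r * r)))"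
    using sum_hits_squared unfolding \<mu>_def by (simp add: algebra_simps power2_eq_square)
  finally show ?thesis unfolding \<mu>_def .
qed

text \<open>For \<open>r \<le> k\<close> the variance bound is divided by \<open>card A * M\<close>,
  and \<open>M\<close> and \<open>p r\<close> are bounded below. The constant is
  \<open>16 = 2 * 4 * 2\<close>: the halves in \<open>M\<close>, those in the square of
  \<open>p r\<close>, and the factor from pairs in the same element.\<close>

lemma evasive_bound: "real (card evasives) / n\<^sub>0 \<le> 16 ^ r * (Q ^ \<gamma> / real (card A))"
proof (cases "r \<le> k")
  case True
  let ?a = "real (card A)" and ?y = "(Q ^ m) ^ r * x ^ r"
  have xpos: "x > 0" using Q_ge_2 by simp
  have M: "(Q ^ m / 2) ^ r \<le> M" using prod_power_diff_ge[OF Q_ge_2 r_le] .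
  have p: "(x / 2) ^ r \<le> p r" using incidence_ratio_ge[OF Q_ge_2 k_less True] .
  have Mpos: "M > 0" using M Q_ge_2 by (intro less_le_trans[OF _ M]) simp
  have "?a * M * (real (card evasives) * ?a * (M * (p r)\<^sup>2)) = real (card evasives) * (?a * M * p r)\<^sup>2"
    by (simp add: power2_eq_square mult_ac)
  also have "\<dots> \<le> ?a * M * (n\<^sub>0 * (2 ^ r * x ^ r * Q ^ (r * r)))"
    using evasive_variance_bound by (simp only: mult_ac)
  finally have 1: "real (card evasives) * ?a * (M * (p r)\<^sup>2) \<le> n\<^sub>0 * (2 ^ r * x ^ r * Q ^ (r * r))"
    using card_spread_pos Mpos by simp
  have "real (card evasives) * ?a * ((Q ^ m / 2) ^ r * ((x / 2) ^ r)\<^sup>2) \<le> real (card evasives) * ?a * (M * (p r)\<^sup>2)"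
    using M p xpos M_nonneg by (intro mult_left_mono mult_mono power_mono) auto
  also note 1
  also have "n\<^sub>0 * (2 ^ r * x ^ r * Q ^ (r * r)) = n\<^sub>0 * 2 ^ r * x ^ r * (Q ^ \<gamma> * ?y)"
    unfolding power_\<gamma>[symmetric] by (simp only: mult_ac)
  finally have "real (card evasives) * ?a * ((Q ^ m / 2) ^ r * ((x / 2) ^ r)\<^sup>2) \<le> n\<^sub>0 * 2 ^ r * x ^ r * (Q ^ \<gamma> * ?y)" .
  moreover have "(Q ^ m / 2) ^ r * ((x / 2) ^ r)\<^sup>2 = x ^ r * ?y / 8 ^ r"
  proof -
    have "(8::real) ^ r = 2 ^ r * (2 ^ r * 2 ^ r)"
      by (simp add: power_mult_distrib[symmetric])
    then show ?thesis by (simp add: power_divide power2_eq_square mult_ac)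
  qed
  ultimately have "real (card evasives) * ?a * (x ^ r * ?y / 8 ^ r) \<le> n\<^sub>0 * 2 ^ r * x ^ r * (Q ^ \<gamma> * ?y)"
    by simp
  moreover define z where "z = x ^ r * ?y"
  ultimately have "real (card evasives) * ?a * (z / 8 ^ r) \<le> n\<^sub>0 * 2 ^ r * (Q ^ \<gamma> * z)"
    by (simp only: mult_ac)
  then have "z * (real (card evasives) * ?a) \<le> z * (n\<^sub>0 * (8 ^ r * 2 ^ r) * Q ^ \<gamma>)"
    by (simp add: pos_divide_le_eq mult_ac)
  moreover have "z > 0" using xpos Q_ge_2 by (simp add: z_def)
  ultimately have "real (card evasives) * ?a \<le> n\<^sub>0 * (8 ^ r * 2 ^ r) * Q ^ \<gamma>"
    by (rule mult_left_le_imp_le)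
  also have "(8::real) ^ r * 2 ^ r = 16 ^ r" by (simp add: power_mult_distrib[symmetric])
  finally have "real (card evasives) * ?a \<le> n\<^sub>0 * 16 ^ r * Q ^ \<gamma>" .
  then show ?thesis using n0_pos card_spread_pos by (simp add: field_simps)
next
  case False
  \<comment> \<open>Every \<open>k\<close>-subspace is evasive, but then a packing bound keeps \<open>A\<close> small.\<close>
  have "card evasives \<le> card \<U>"
    using finite_subspaces_of_dim by (intro card_mono) auto
  then have "real (card evasives) / n\<^sub>0 \<le> 1" using n0_pos by simp
  also have "1 \<le> 16 ^ r * (Q ^ \<gamma> / real (card A))"
  proof -
    \<comment> \<open>Since \<open>k < r\<close>, the second factor of \<open>\<gamma>\<close> is at
      least \<open>N - m\<close>; the factor \<open>2\<close> of the packing bound is absorbed by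
      \<open>16 ^ r\<close>.\<close>
    have "N - m \<le> 1 * (N + r - k - m)" using False mk_le by simp
    also have "\<dots> \<le> \<gamma>" using r_pos by (intro mult_right_mono) auto
    finally have "Q ^ (N - m) \<le> Q ^ \<gamma>" using Q_ge_2 by (intro power_increasing) auto
    moreover have "(2::real) \<le> 16 ^ r"
      using power_increasing[of 1 r "16::real"] r_pos by simp
    ultimately have "2 * Q ^ (N - m) \<le> 16 ^ r * Q ^ \<gamma>"
      using Q_ge_2 by (intro mult_mono) auto
    then have "real (card A) \<le> 16 ^ r * Q ^ \<gamma>" using card_spread_le by linarith
    then show ?thesis using card_spread_pos by simp
  qed
  finally show ?thesis .
qed

lemma ratio_bounds:
  "\<bar>real (card evasives) / n\<^sub>0 - 1\<bar> \<le> 2 ^ r * (real (card A) / Q ^ \<gamma>)"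
  "\<bar>real (card evasives) / n\<^sub>0\<bar> \<le> 16 ^ r * (Q ^ \<gamma> / real (card A))"
proof -
  have "card evasives \<le> card \<U>"
    using finite_subspaces_of_dim by (intro card_mono) auto
  moreover have "card (\<U> - evasives) = card \<U> - card evasives"
    using finite_subspaces_of_dim by (intro card_Diff_subset) auto
  ultimately have "\<bar>real (card evasives) / n\<^sub>0 - 1\<bar> = real (card (\<U> - evasives)) / n\<^sub>0"
    using n0_pos by (simp add: of_nat_diff field_simps)
  then show "\<bar>real (card evasives) / n\<^sub>0 - 1\<bar> \<le> 2 ^ r * (real (card A) / Q ^ \<gamma>)"
    using not_evasive_bound by simp
  show "\<bar>real (card evasives) / n\<^sub>0\<bar> \<le> 16 ^ r * (Q ^ \<gamma> / real (card A))"
    using evasive_bound by simp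
qed

end

section \<open>Passage to the limit along the prime powers\<close>

theorem theorem5p4:
  fixes N k m h \<gamma> :: nat
    and K :: "nat \<Rightarrow> 'a ring"
    and X :: "nat \<Rightarrow> ('a, 'b) module"
    and \<A> :: "nat \<Rightarrow> 'b set set"
  assumes "N \<ge> 2"
    and "1 \<le> k" and "k \<le> N"
    and "1 \<le> m" and "m \<le> N - k"
    and "1 \<le> h" and "h \<le> m - 1"
    and field: "\<And>q. primepow q \<Longrightarrow> field (K q) \<and> card (carrier (K q)) = q"
    and space: "\<And>q. primepow q \<Longrightarrow>
      vectorspace (K q) (X q) \<and> vectorspace.fin_dim (K q) (X q) \<and> vectorspace.dim (K q) (X q) = N"
    and spread: "\<And>q. primepow q \<Longrightarrow> partial_spread (K q) (X q) m (\<A> q) \<and> card (\<A> q) \<ge> 2"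
    and gamma: "\<gamma> = (h + 1) * (N + h + 1 - k - m)"
  defines "ratio \<equiv> \<lambda>q. real (card {U \<in> subspaces_of_dim (K q) (X q) k. evasive (K q) (X q) (\<A> q) h U})
                         / real (q_binomial (K q) N k)"
  shows "((\<lambda>q. real (card (\<A> q))) \<in> o[prime_powers_at_top](\<lambda>q. real q ^ \<gamma>)
            \<longrightarrow> (ratio \<longlongrightarrow> 1) prime_powers_at_top) \<and>
         ((\<lambda>q. real q ^ \<gamma>) \<in> o[prime_powers_at_top](\<lambda>q. real (card (\<A> q)))
            \<longrightarrow> (ratio \<longlongrightarrow> 0) prime_powers_at_top)"
proof -
  let ?r = "h + 1"
  \<comment> \<open>The constants depend on \<open>h\<close> only, not on \<open>q\<close>, so each
    little-o hypothesis forces the corresponding error to zero.\<close>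
  have bounds: "\<bar>ratio q - 1\<bar> \<le> 2 ^ ?r * (real (card (\<A> q)) / real q ^ \<gamma>)"
    "\<bar>ratio q\<bar> \<le> 16 ^ ?r * (real q ^ \<gamma> / real (card (\<A> q)))" if q: "primepow q" for q
  proof -
    have card_K: "card (carrier (K q)) = q" using field[OF q] by simp
    have q1: "q > 1" using primepow_gt_Suc_0[OF q] by simp
    interpret V: vectorspace "K q" "X q" using space[OF q] by simp
    obtain B where "finite B" "V.basis B" "card B = N"
      using V.finite_basis_exists V.dim_basis space[OF q] by metis
    then have card_X: "card (carrier (X q)) = q ^ N"
      using V.card_finite_basis card_K by metis
    \<comment> \<open>An infinite set has \<open>card\<close> zero, so a positive cardinality proves
      finiteness.\<close>
    have fin: "finite (carrier (K q))" "finite (carrier (X q))"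
      using card_K card_X q1 by (auto intro!: card_ge_0_finite)
    interpret partial_spread_space "K q" "X q" N k m ?r "\<A> q"
    proof (unfold_locales)
      show "finite (carrier (K q))" "finite (carrier (X q))" by (fact fin)+
      show "card (carrier (X q)) = card (carrier (K q)) ^ N" using card_K card_X by simp
      show "m + k \<le> N" using assms(3,5) by simp
      show "?r \<le> m" using assms(4,7) by simp
      show "\<A> q \<noteq> {}" using spread[OF q] by auto
    qed (use assms(4,6) spread[OF q] in auto)
    have "ratio q = real (card evasives) / n\<^sub>0"
      unfolding ratio_def using q_binomial_eq[OF card_vectors] by simp
    moreover have "?r * (N + ?r - k - m) = \<gamma>" by (simp add: gamma)
    ultimately show "\<bar>ratio q - 1\<bar> \<le> 2 ^ ?r * (real (card (\<A> q)) / real q ^ \<gamma>)"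
      "\<bar>ratio q\<bar> \<le> 16 ^ ?r * (real q ^ \<gamma> / real (card (\<A> q)))"
      using ratio_bounds unfolding card_K by simp_all
  qed
  show ?thesis
  proof (intro conjI impI)
    assume "(\<lambda>q. real (card (\<A> q))) \<in> o[prime_powers_at_top](\<lambda>q. real q ^ \<gamma>)"
    from smalloD_tendsto[OF this]
    have "((\<lambda>q. ratio q - 1) \<longlongrightarrow> 0) prime_powers_at_top"
      \<comment> \<open>The quotient of the little-o hypothesis tends to zero and dominates up to a
        constant. The filter is restricted to prime powers, so the bound is required only
        there.\<close>
      by (rule tendsto_0_le[where K = "2 ^ ?r"])
        (use bounds(1) in \<open>auto simp: eventually_inf_principal mult.commute\<close>)
    then show "(ratio \<longlongrightarrow> 1) prime_powers_at_top"
      by (rule LIM_zero_cancel)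
  next
    assume "(\<lambda>q. real q ^ \<gamma>) \<in> o[prime_powers_at_top](\<lambda>q. real (card (\<A> q)))"
    from smalloD_tendsto[OF this]
    show "(ratio \<longlongrightarrow> 0) prime_powers_at_top"
      by (rule tendsto_0_le[where K = "16 ^ ?r"])
        (use bounds(2) in \<open>auto simp: eventually_inf_principal mult.commute\<close>)
  qed
qed

end
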